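(* Let $y$ be a square-integrable function of $\mathbf{X}$ with generalized ADD $y(\mathbf{X})=\sum_{u\subseteq\{1,\dots,N\}}y_{u,G}(\mathbf{X}_u)$. Then the mean of $y(\mathbf{X})$ is $$\mu:=\mathbb{E}[y(\mathbf{X})]=y_{\emptyset,G},$$ and the variance of $y(\mathbf{X})$ is $$\sigma^2:=\mathbb{E}\left[(y(\mathbf{X})-\mu)^2\right]=\sum_{\emptyset\neq u\subseteq\{1,\dots,N\}}\mathbb{E}\left[y_{u,G}^2(\mathbf{X}_u)\right]+\sum_{\substack{\emptyset\neq u,v\subseteq\{1,\dots,N\}\\ u\nsubseteq v\nsubseteq u}}\mathbb{E}\left[y_{u,G}(\mathbf{X}_u)\,y_{v,G}(\mathbf{X}_v)\right],$$ where the second sum runs over all ordered pairs $(u,v)$ of nonempty subsets of $\{1,\dots,N\}$ with $u\nsubseteq v$ and $v\nsubseteq u$.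
   Context: Let $N\in\mathbb{N}$ and let $\mathbf{X}=(X_1,\dots,X_N)$ be an $\mathbb{R}^N$-valued random vector on a complete probability space, with joint probability density function $f_{\mathbf{X}}:\mathbb{R}^N\to[0,\infty)$, not necessarily of product type. For $u\subseteq\{1,\dots,N\}$, $|u|$ is its cardinality, $-u:=\{1,\dots,N\}\setminus u$, $\mathbf{X}_u=(X_i)_{i\in u}$ and $\mathbf{x}_u=(x_i)_{i\in u}$. For $u\neq\emptyset$ the marginal density of $\mathbf{X}_u$ is $f_u(\mathbf{x}_u):=\int_{\mathbb{R}^{N-|u|}}f_{\mathbf{X}}(\mathbf{x})\,d\mathbf{x}_{-u}$. The support of $f_{\mathbf{X}}$ is assumed grid-closed: for any point $\mathbf{x}\in\mathrm{supp}(f_{\mathbf{X}})$ one can traverse in each coordinate direction and find another point $\mathbf{x}'\in\mathrm{supp}(f_{\mathbf{X}})$. Generalized ADD (ANOVA dimensional decomposition): the decomposition $y(\mathbf{X})=\sum_{u\subseteq\{1,\dots,N\}}y_{u,G}(\mathbf{X}_u)$ of a square-integrable function $y$ (that is, $\mathbb{E}[y(\mathbf{X})^2]<\infty$), where $y_{\emptyset,G}$ is a constant, each $y_{u,G}$ with $u\ne\emptyset$ is a function of $\mathbf{x}_u$ with $\int_{\mathbb{R}^{|u|}}y_{u,G}^2(\mathbf{x}_u)f_u(\mathbf{x}_u)\,d\mathbf{x}_u<\infty$, and the weak annihilating conditions hold: $$\int_{\mathbb{R}}y_{u,G}(\mathbf{x}_u)f_u(\mathbf{x}_u)\,dx_i=0\quad\text{for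 every } i\in u\neq\emptyset$$ (for almost every value of the remaining variables $x_j$, $j\in u\setminus\{i\}$). *)

theory Defs
  imports "HOL-Probability.Probability"
begin

text \<open>
  Points of the space with coordinates indexed by a finite set \<open>u\<close> of naturals are extensional
  functions, that is, elements of \<open>space (PiM u _)\<close>; \<open>restrict x u\<close> is the projection of \<open>x\<close>
  to the coordinates in \<open>u\<close>.
\<close>

abbreviation lborel_on :: "nat set \<Rightarrow> (nat \<Rightarrow> real) measure" where
  "lborel_on u \<equiv> PiM u (\<lambda>_. lborel)"

text \<open>
  Points where the fibre integral of a density is infinite form a null set; there the value
  is 0 by the convention of the Bochner integral.
\<close>

definition marginal_density ::
  "nat \<Rightarrow> ((nat \<Rightarrow> real) \<Rightarrow> real) \<Rightarrow> nat set \<Rightarrow> (nat \<Rightarrow> real) \<Rightarrow> real" where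
  "marginal_density N f u x =
     (\<integral>z. f (merge u ({1..N} - u) (x, z)) \<partial>lborel_on ({1..N} - u))"

text \<open>
  The closure is taken in the product topology on all functions. The extensional functions
  on \<open>{1..N}\<close> form a closed subspace of it, homeomorphic to Euclidean \<open>N\<close>-space.
\<close>

definition density_support :: "nat \<Rightarrow> ((nat \<Rightarrow> real) \<Rightarrow> real) \<Rightarrow> (nat \<Rightarrow> real) set" where
  "density_support N f = closure {x \<in> extensional {1..N}. f x \<noteq> 0}"

definition grid_closed :: "nat \<Rightarrow> (nat \<Rightarrow> real) set \<Rightarrow> bool" where
  "grid_closed N S \<longleftrightarrow> (\<forall>x\<in>S. \<forall>i\<in>{1..N}. \<exists>t. t \<noteq> x i \<and> x(i := t) \<in> S)"

definition square_integrable :: "'a measure \<Rightarrow> ('a \<Rightarrow> real) \<Rightarrow> bool" where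
  "square_integrable M Z \<longleftrightarrow> Z \<in> borel_measurable M \<and> integrable M (\<lambda>\<omega>. (Z \<omega>)\<^sup>2)"

text \<open>
  In the annihilating condition the function being integrated over coordinate \<open>i\<close> is integrable
  for almost every value of the remaining coordinates, by the square-integrability of
  the component functions and Fubini's theorem, so the value 0 never stems from the convention
  for non-integrable functions except on a null set.
\<close>

definition weak_annihilating ::
  "nat \<Rightarrow> ((nat \<Rightarrow> real) \<Rightarrow> real) \<Rightarrow> nat set \<Rightarrow> ((nat \<Rightarrow> real) \<Rightarrow> real) \<Rightarrow> bool" where
  "weak_annihilating N f u g \<longleftrightarrow>
     (\<forall>i\<in>u. AE x in lborel_on (u - {i}).
        (\<integral>t. g (x(i := t)) * marginal_density N f u (x(i := t)) \<partial>lborel) = 0)"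

definition generalized_ADD ::
  "'a measure \<Rightarrow> nat \<Rightarrow> ('a \<Rightarrow> nat \<Rightarrow> real) \<Rightarrow> ((nat \<Rightarrow> real) \<Rightarrow> real) \<Rightarrow> ((nat \<Rightarrow> real) \<Rightarrow> real) \<Rightarrow>
     real \<Rightarrow> (nat set \<Rightarrow> (nat \<Rightarrow> real) \<Rightarrow> real) \<Rightarrow> bool" where
  "generalized_ADD M N X f y c yG \<longleftrightarrow>
     (AE \<omega> in M. y (X \<omega>) = (\<Sum>u\<in>Pow {1..N}. yG u (restrict (X \<omega>) u))) \<and>
     yG {} = (\<lambda>_. c) \<and>
     (\<forall>u. u \<subseteq> {1..N} \<and> u \<noteq> {} \<longrightarrow>
        yG u \<in> borel_measurable (lborel_on u) \<and>
        integrable (lborel_on u) (\<lambda>x. (yG u x)\<^sup>2 * marginal_density N f u x) \<and>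
        weak_annihilating N f u (yG u))"

end

theory Submission
  imports Defs
begin

text \<open>
  If \<open>v \<subset> u\<close>, the component indexed by \<open>v\<close> does not depend on a coordinate \<open>i \<in> u - v\<close>.
  Integrating first over that coordinate and using the weak annihilating condition shows that
  the components indexed by \<open>u\<close> and \<open>v\<close> are orthogonal. With \<open>v = {}\<close> this gives the mean;
  in the expansion of the variance it removes all comparable pairs except the diagonal.
\<close>

section \<open>Marginal densities of projections of the random vector\<close>

text \<open>Tonelli integrates the coordinates outside \<open>u\<close> out of the joint density.
  This turns expectations of functions of the projected vector into integrals against the marginal
  density, the form in which the annihilating conditions are given.\<close>

lemma distributed_marginal_density:
  fixes f :: "(nat \<Rightarrow> real) \<Rightarrow> real"
  assumes M: "prob_space M"
    and f_nonneg: "\<And>x. x \<in> space (lborel_on {1..N}) \<Longrightarrow> 0 \<le> f x"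
    and X: "distributed M (lborel_on {1..N}) X (\<lambda>x. ennreal (f x))"
    and u: "u \<subseteq> {1..N}"
  shows "distributed M (lborel_on u) (\<lambda>\<omega>. restrict (X \<omega>) u)
           (\<lambda>x. ennreal (marginal_density N f u x))"
proof -
  interpret prob_space M by fact
  interpret P: product_sigma_finite "\<lambda>_::nat. lborel :: real measure"
    by standard
  let ?w = "{1..N} - u"
  have fin: "finite u" "finite ?w" and uw: "u \<union> ?w = {1..N}"
    using u finite_subset by auto
  have Xm [measurable]: "X \<in> measurable M (lborel_on {1..N})"
    and fm: "(\<lambda>x. ennreal (f x)) \<in> borel_measurable (lborel_on {1..N})"
    using X by (auto simp: distributed_def)
  have fm' [measurable]: "f \<in> borel_measurable (lborel_on (u \<union> ?w))"
    using distributed_real_measurable[OF f_nonneg X] uw by simp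
  \<comment> \<open>Sigma-finiteness makes the parametric integrals over the remaining coordinates
    measurable in \<open>x\<close>.\<close>
  interpret S: sigma_finite_measure "lborel_on ?w"
    by (rule P.sigma_finite) (rule fin)
  have res [measurable]: "(\<lambda>\<omega>. restrict (X \<omega>) u) \<in> measurable M (lborel_on u)"
    by (rule measurable_compose[OF Xm measurable_restrict_subset[OF u]])
  have marg [measurable]: "marginal_density N f u \<in> borel_measurable (lborel_on u)"
    unfolding marginal_density_def by measurable
  \<comment> \<open>The marginal density as a nonnegative integral, possibly infinite at some
    \<open>x\<close>. Tonelli applies to it before any finiteness is known; the Bochner version
    enters only at the end.\<close>
  let ?g = "\<lambda>x. \<integral>\<^sup>+z. ennreal (f (merge u ?w (x, z))) \<partial>lborel_on ?w"
  have g [measurable]: "?g \<in> borel_measurable (lborel_on u)"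
    by measurable
  have merge_space: "merge u ?w (x, z) \<in> space (lborel_on {1..N})"
    if "x \<in> space (lborel_on u)" "z \<in> space (lborel_on ?w)" for x z
    using that u by (auto simp: space_PiM PiE_def extensional_def merge_def)
  have emeas: "emeasure M ((\<lambda>\<omega>. restrict (X \<omega>) u) -` A \<inter> space M)
      = (\<integral>\<^sup>+x. ?g x * indicator A x \<partial>lborel_on u)"
    if [measurable]: "A \<in> sets (lborel_on u)" for A
  proof -
    have ind [measurable]:
      "(\<lambda>x. indicator A (restrict x u) :: ennreal) \<in> borel_measurable (lborel_on {1..N})"
      by (rule measurable_compose[OF measurable_restrict_subset[OF u]]) measurable
    have "emeasure M ((\<lambda>\<omega>. restrict (X \<omega>) u) -` A \<inter> space M)
        = (\<integral>\<^sup>+\<omega>. indicator ((\<lambda>\<omega>. restrict (X \<omega>) u) -` A \<inter> space M) \<omega> \<partial>M)"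
      by (subst nn_integral_indicator) (auto intro: measurable_sets[OF res])
    also have "\<dots> = (\<integral>\<^sup>+\<omega>. indicator A (restrict (X \<omega>) u) \<partial>M)"
      by (intro nn_integral_cong) (simp add: indicator_def)
    also have "\<dots> = (\<integral>\<^sup>+x. ennreal (f x) * indicator A (restrict x u) \<partial>lborel_on {1..N})"
      using distributed_nn_integral[OF X ind] by simp
    also have "\<dots> = (\<integral>\<^sup>+x. (\<integral>\<^sup>+z. ennreal (f (merge u ?w (x, z))) *
        indicator A (restrict (merge u ?w (x, z)) u) \<partial>lborel_on ?w) \<partial>lborel_on u)"
      using P.product_nn_integral_fold[OF _ fin,
          of "\<lambda>x. ennreal (f x) * indicator A (restrict x u)"] ind fm uw
      by simp
    also have "\<dots> = (\<integral>\<^sup>+x. ?g x * indicator A x \<partial>lborel_on u)"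
    proof (rule nn_integral_cong)
      \<comment> \<open>The projection of the merged point is \<open>x\<close> itself, so the
        indicator is constant in \<open>z\<close> and leaves the inner integral.\<close>
      fix x assume "x \<in> space (lborel_on u)"
      then have restr: "restrict (merge u ?w (x, z)) u = x" for z
        by (auto simp: space_PiM PiE_def extensional_restrict)
      have [measurable]: "(\<lambda>z. f (merge u ?w (x, z))) \<in> borel_measurable (lborel_on ?w)"
        using \<open>x \<in> space (lborel_on u)\<close> by measurable
      show "(\<integral>\<^sup>+z. ennreal (f (merge u ?w (x, z))) *
          indicator A (restrict (merge u ?w (x, z)) u) \<partial>lborel_on ?w) = ?g x * indicator A x"
        unfolding restr by (rule nn_integral_multc) measurable
    qed
    finally show ?thesis .
  qed
  \<comment> \<open>The case of \<open>emeas\<close> where \<open>A\<close> is the whole space: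
    total mass 1 forces \<open>?g\<close> to be finite almost everywhere.\<close>
  have "(\<integral>\<^sup>+x. ?g x \<partial>lborel_on u) = 1"
  proof -
    have "(\<lambda>\<omega>. restrict (X \<omega>) u) -` space (lborel_on u) \<inter> space M = space M"
      using measurable_space[OF res] by auto
    then have "1 = (\<integral>\<^sup>+x. ?g x * indicator (space (lborel_on u)) x \<partial>lborel_on u)"
      using emeas[of "space (lborel_on u)"] by (simp add: emeasure_space_1)
    also have "\<dots> = (\<integral>\<^sup>+x. ?g x \<partial>lborel_on u)"
      by (intro nn_integral_cong) simp
    finally show ?thesis by simp
  qed
  then have "AE x in lborel_on u. ?g x \<noteq> \<infinity>"
    by (intro nn_integral_PInf_AE g) simp
  \<comment> \<open>Where \<open>?g\<close> is infinite the Bochner integral defaults to 0, so the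
    two versions agree only almost everywhere; a density is determined only up to that
    anyway.\<close>
  then have AE: "AE x in lborel_on u. ?g x = ennreal (marginal_density N f u x)"
  proof (rule AE_mp, intro AE_I2 impI)
    fix x assume x: "x \<in> space (lborel_on u)" and fin_g: "?g x \<noteq> \<infinity>"
    have [measurable]: "(\<lambda>z. f (merge u ?w (x, z))) \<in> borel_measurable (lborel_on ?w)"
      using x by measurable
    have nn: "AE z in lborel_on ?w. 0 \<le> f (merge u ?w (x, z))"
      by (rule AE_I2) (rule f_nonneg[OF merge_space[OF x]])
    have "integrable (lborel_on ?w) (\<lambda>z. f (merge u ?w (x, z)))"
    proof (rule integrableI_nonneg[OF _ nn])
      show "?g x < \<infinity>"
        using fin_g by (simp add: top.not_eq_extremum)
    qed measurable
    then show "?g x = ennreal (marginal_density N f u x)"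
      unfolding marginal_density_def by (intro nn_integral_eq_integral nn)
  qed
  show ?thesis
    unfolding distributed_def
  proof (intro conjI res)
    show "distr M (lborel_on u) (\<lambda>\<omega>. restrict (X \<omega>) u)
        = density (lborel_on u) (\<lambda>x. ennreal (marginal_density N f u x))"
    proof (rule measure_eqI)
      fix A assume "A \<in> sets (distr M (lborel_on u) (\<lambda>\<omega>. restrict (X \<omega>) u))"
      then have A: "A \<in> sets (lborel_on u)" by simp
      show "emeasure (distr M (lborel_on u) (\<lambda>\<omega>. restrict (X \<omega>) u)) A
          = emeasure (density (lborel_on u) (\<lambda>x. ennreal (marginal_density N f u x))) A"
        using A AE
        by (auto simp: emeasure_distr emeasure_density emeas intro!: nn_integral_cong_AE)
    qed simp
  qed measurable
qed

section \<open>Products of components: integrability and orthogonality\<close>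

text \<open>The inequality of arithmetic and geometric means bounds the product by the sum of
  squares. All cross expectations in the variance thereby exist, and linearity may be used
  freely.\<close>

lemma integrable_mult_of_square_integrable:
  fixes Y Z :: "'a \<Rightarrow> real"
  assumes Y: "square_integrable M Y" and Z: "square_integrable M Z"
  shows "integrable M (\<lambda>\<omega>. Y \<omega> * Z \<omega>)"
proof (rule Bochner_Integration.integrable_bound)
  show "integrable M (\<lambda>\<omega>. (Y \<omega>)\<^sup>2 + (Z \<omega>)\<^sup>2)"
    using Y Z by (simp add: square_integrable_def)
  show "(\<lambda>\<omega>. Y \<omega> * Z \<omega>) \<in> borel_measurable M"
    using Y Z unfolding square_integrable_def by (intro borel_measurable_times) auto
  show "AE \<omega> in M. norm (Y \<omega> * Z \<omega>) \<le> norm ((Y \<omega>)\<^sup>2 + (Z \<omega>)\<^sup>2)"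
  proof (rule AE_I2)
    fix \<omega>
    have "2 * (\<bar>Y \<omega>\<bar> * \<bar>Z \<omega>\<bar>) \<le> (Y \<omega>)\<^sup>2 + (Z \<omega>)\<^sup>2"
      using sum_squares_bound[of "\<bar>Y \<omega>\<bar>" "\<bar>Z \<omega>\<bar>"] by simp
    moreover have "0 \<le> \<bar>Y \<omega>\<bar> * \<bar>Z \<omega>\<bar>" by simp
    ultimately show "norm (Y \<omega> * Z \<omega>) \<le> norm ((Y \<omega>)\<^sup>2 + (Z \<omega>)\<^sup>2)"
      unfolding real_norm_def abs_mult by linarith
  qed
qed

text \<open>The second factor is an arbitrary \<open>h\<close>, not a component, so that
  \<open>h = 1\<close> with \<open>v = {}\<close> also yields that components have mean
  zero.\<close>

lemma expectation_mult_eq_0_of_weak_annihilating: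
  fixes g h :: "(nat \<Rightarrow> real) \<Rightarrow> real"
  assumes "finite u"
    and X: "distributed M (lborel_on u) (\<lambda>\<omega>. restrict (X \<omega>) u)
          (\<lambda>x. ennreal (marginal_density N f u x))"
    and marg_nonneg: "\<And>x. x \<in> space (lborel_on u) \<Longrightarrow> 0 \<le> marginal_density N f u x"
    and g: "g \<in> borel_measurable (lborel_on u)"
    and h: "h \<in> borel_measurable (lborel_on v)"
    and int: "integrable M (\<lambda>\<omega>. g (restrict (X \<omega>) u) * h (restrict (X \<omega>) v))"
    and wa: "weak_annihilating N f u g"
    and "v \<subset> u"
  shows "(\<integral>\<omega>. g (restrict (X \<omega>) u) * h (restrict (X \<omega>) v) \<partial>M) = 0"
proof -
  interpret P: product_sigma_finite "\<lambda>_::nat. lborel :: real measure"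
    by standard
  obtain i where i: "i \<in> u" "i \<notin> v"
    using \<open>v \<subset> u\<close> by blast
  have u: "insert i (u - {i}) = u"
    using i by blast
  have inter: "u \<inter> v = v"
    using \<open>v \<subset> u\<close> by blast
  \<comment> \<open>Since \<open>v\<close> lies in \<open>u\<close>, both factors become one
    function of the \<open>u\<close>-coordinates, and the law of the projection to \<open>u\<close>
    alone determines the expectation.\<close>
  let ?k = "\<lambda>x. g x * h (restrict x v)"
  let ?F = "\<lambda>x. marginal_density N f u x * ?k x"
  have "(\<lambda>x. h (restrict x v)) \<in> borel_measurable (lborel_on u)"
    using \<open>v \<subset> u\<close> by (intro measurable_compose[OF measurable_restrict_subset h]) auto
  with g have k: "?k \<in> borel_measurable (lborel_on u)"
    by simp
  have kX: "?k (restrict (X \<omega>) u) = g (restrict (X \<omega>) u) * h (restrict (X \<omega>) v)" for \<omega>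
    by (simp add: restrict_restrict inter)
  \<comment> \<open>Integrability under \<open>M\<close> passes to Lebesgue measure with the density
    as weight, as Fubini requires for integrating over coordinate \<open>i\<close> first.\<close>
  have F: "integrable (lborel_on (insert i (u - {i}))) ?F"
    unfolding u using distributed_integrable[OF X k marg_nonneg] int unfolding kX by simp
  have "(\<integral>\<omega>. g (restrict (X \<omega>) u) * h (restrict (X \<omega>) v) \<partial>M) = integral\<^sup>L (lborel_on u) ?F"
    using distributed_integral[OF X k marg_nonneg] unfolding kX by simp
  also have "\<dots> = (\<integral>x. (\<integral>t. ?F (x(i := t)) \<partial>lborel) \<partial>lborel_on (u - {i}))"
    using P.product_integral_insert[OF _ _ F] \<open>finite u\<close> unfolding u by simp
  also have "\<dots> = 0"
  proof (rule integral_eq_zero_AE)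
    have "AE x in lborel_on (u - {i}).
        (\<integral>t. g (x(i := t)) * marginal_density N f u (x(i := t)) \<partial>lborel) = 0"
      using wa i unfolding weak_annihilating_def by blast
    then show "AE x in lborel_on (u - {i}). (\<integral>t. ?F (x(i := t)) \<partial>lborel) = 0"
    proof (rule AE_mp, intro AE_I2 impI)
      fix x
      assume zero: "(\<integral>t. g (x(i := t)) * marginal_density N f u (x(i := t)) \<partial>lborel) = 0"
      \<comment> \<open>Because \<open>i\<close> is outside \<open>v\<close>, the factor
        \<open>h\<close> is constant along the line in direction \<open>i\<close>; what remains is
        the annihilating integral.\<close>
      have restr: "restrict (x(i := t)) v = restrict x v" for t
        using i(2) by (auto simp: restrict_def)
      have "(\<lambda>t. ?F (x(i := t)))
          = (\<lambda>t. h (restrict x v) * (g (x(i := t)) * marginal_density N f u (x(i := t))))"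
        by (simp add: restr fun_eq_iff)
      then show "(\<integral>t. ?F (x(i := t)) \<partial>lborel) = 0"
        by (simp only: integral_mult_right_zero zero mult_zero_right)
    qed
  qed
  finally show ?thesis .
qed

section \<open>Mean and variance\<close>

theorem mainTheorem6:
  fixes M :: "'a measure" and N :: nat
    and X :: "'a \<Rightarrow> nat \<Rightarrow> real"
    and f y :: "(nat \<Rightarrow> real) \<Rightarrow> real"
    and c :: real
    and yG :: "nat set \<Rightarrow> (nat \<Rightarrow> real) \<Rightarrow> real"
  assumes "prob_space M" and "complete_measure M"
    and "\<And>x. x \<in> space (lborel_on {1..N}) \<Longrightarrow> 0 \<le> f x"
    and "distributed M (lborel_on {1..N}) X (\<lambda>x. ennreal (f x))"
    and "grid_closed N (density_support N f)"
    and "square_integrable M (\<lambda>\<omega>. y (X \<omega>))"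
    and "generalized_ADD M N X f y c yG"
  shows "prob_space.expectation M (\<lambda>\<omega>. y (X \<omega>)) = c \<and>
    prob_space.variance M (\<lambda>\<omega>. y (X \<omega>)) =
      (\<Sum>u | u \<subseteq> {1..N} \<and> u \<noteq> {}.
         prob_space.expectation M (\<lambda>\<omega>. (yG u (restrict (X \<omega>) u))\<^sup>2)) +
      (\<Sum>(u, v) | u \<subseteq> {1..N} \<and> v \<subseteq> {1..N} \<and> u \<noteq> {} \<and> v \<noteq> {} \<and> \<not> u \<subseteq> v \<and> \<not> v \<subseteq> u.
         prob_space.expectation M
           (\<lambda>\<omega>. yG u (restrict (X \<omega>) u) * yG v (restrict (X \<omega>) v)))"
proof -
  interpret prob_space M by fact
  let ?A = "{u. u \<subseteq> {1..N} \<and> u \<noteq> {}}"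
  let ?C = "{(u, v). u \<subseteq> {1..N} \<and> v \<subseteq> {1..N} \<and> u \<noteq> {} \<and> v \<noteq> {} \<and> \<not> u \<subseteq> v \<and> \<not> v \<subseteq> u}"
  define Y where "Y = (\<lambda>u \<omega>. yG u (restrict (X \<omega>) u))"
  \<comment> \<open>The Gram matrix of the components, from which the variance is read off.\<close>
  define E where "E = (\<lambda>u v. expectation (\<lambda>\<omega>. Y u \<omega> * Y v \<omega>))"
  have A: "finite ?A" "Pow {1..N} = insert {} ?A"
    by auto
  have empty: "yG {} = (\<lambda>_. c)"
    and decomp: "AE \<omega> in M. y (X \<omega>) = (\<Sum>u\<in>Pow {1..N}. Y u \<omega>)"
    using assms(7) unfolding generalized_ADD_def Y_def by auto
  have comp: "yG u \<in> borel_measurable (lborel_on u)"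
      "integrable (lborel_on u) (\<lambda>x. (yG u x)\<^sup>2 * marginal_density N f u x)"
      "weak_annihilating N f u (yG u)" if "u \<in> ?A" for u
    using assms(7) that unfolding generalized_ADD_def Y_def by auto
  have Y_empty: "Y {} = (\<lambda>_. c)"
    by (simp add: Y_def empty)
  have yG_meas: "yG u \<in> borel_measurable (lborel_on u)" if "u \<subseteq> {1..N}" for u
    using that comp(1) by (cases "u = {}") (auto simp: empty)
  have dist: "distributed M (lborel_on u) (\<lambda>\<omega>. restrict (X \<omega>) u)
      (\<lambda>x. ennreal (marginal_density N f u x))" if "u \<subseteq> {1..N}" for u
    by (rule distributed_marginal_density[OF assms(1,3,4) that])
  \<comment> \<open>This holds at every point, because the default value 0 of a divergent integral
    is nonnegative too.\<close>
  have marg_nonneg: "0 \<le> marginal_density N f u x"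
    if "u \<subseteq> {1..N}" "x \<in> space (lborel_on u)" for u x
    unfolding marginal_density_def using that
    by (intro integral_nonneg_AE AE_I2 assms(3))
      (auto simp: space_PiM PiE_def extensional_def merge_def)
  \<comment> \<open>For nonempty \<open>u\<close>, the weighted integrability in the decomposition
    is the finiteness of the second moment under the law of the projection. For
    \<open>u = {}\<close> the component is a constant on a probability space.\<close>
  have sq: "square_integrable M (Y u)" if u: "u \<subseteq> {1..N}" for u
  proof (cases "u = {}")
    case True
    then show ?thesis by (simp add: square_integrable_def Y_empty)
  next
    case False
    with u have uA: "u \<in> ?A" by simp
    have "(\<lambda>\<omega>. restrict (X \<omega>) u) \<in> measurable M (lborel_on u)"
      using dist[OF u] by (simp add: distributed_def)
    then have "Y u \<in> borel_measurable M"
      unfolding Y_def by (rule measurable_compose[OF _ yG_meas[OF u]])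
    moreover have "(\<lambda>x. (yG u x)\<^sup>2) \<in> borel_measurable (lborel_on u)"
      using yG_meas[OF u] by simp
    then have "integrable M (\<lambda>\<omega>. (Y u \<omega>)\<^sup>2)"
      using distributed_integrable[OF dist[OF u], of "\<lambda>x. (yG u x)\<^sup>2"] marg_nonneg[OF u]
        comp(2)[OF uA] unfolding Y_def by (simp add: mult.commute)
    ultimately show ?thesis by (simp add: square_integrable_def)
  qed
  have int: "integrable M (\<lambda>\<omega>. Y u \<omega> * Y v \<omega>)" if "u \<subseteq> {1..N}" "v \<subseteq> {1..N}" for u v
    using that by (intro integrable_mult_of_square_integrable sq)
  have orth: "E u v = 0" if "u \<subseteq> {1..N}" "v \<subset> u" for u v
  proof -
    have "v \<subseteq> {1..N}" "u \<in> ?A" using that by auto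
    then show ?thesis
      unfolding E_def Y_def using that int[of u v]
      by (intro expectation_mult_eq_0_of_weak_annihilating[OF _ dist marg_nonneg yG_meas yG_meas])
        (auto simp: Y_def comp finite_subset[of u "{1..N}"])
  qed
  have E_commute: "E u v = E v u" for u v
    by (simp add: E_def mult.commute)
  have meas [measurable]: "Y u \<in> borel_measurable M" if "u \<subseteq> {1..N}" for u
    using sq[OF that] by (simp add: square_integrable_def)
  have y_meas [measurable]: "(\<lambda>\<omega>. y (X \<omega>)) \<in> borel_measurable M"
    using assms(6) by (simp add: square_integrable_def)
  have sum_meas [measurable]: "(\<lambda>\<omega>. \<Sum>u\<in>?A. Y u \<omega>) \<in> borel_measurable M"
    by (intro borel_measurable_sum meas) simp
  have decomp': "AE \<omega> in M. y (X \<omega>) = c + (\<Sum>u\<in>?A. Y u \<omega>)"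
  proof -
    have "(\<Sum>u\<in>Pow {1..N}. Y u \<omega>) = c + (\<Sum>u\<in>?A. Y u \<omega>)" for \<omega>
      unfolding A(2) by (subst sum.insert[OF A(1)]) (simp_all add: Y_empty)
    with decomp show ?thesis by (simp only:)
  qed
  have int1: "integrable M (Y u)" if "u \<subseteq> {1..N}" for u
    using sq[OF that] unfolding square_integrable_def
    by (blast intro: square_integrable_imp_integrable)
  \<comment> \<open>Orthogonality is applied to the constant 1 rather than to \<open>Y {}\<close>:
    the latter is \<open>c\<close>, and \<open>c = 0\<close> would say nothing about the
    mean.\<close>
  have mean0: "expectation (Y u) = 0" if "u \<in> ?A" for u
    using expectation_mult_eq_0_of_weak_annihilating[OF _ dist marg_nonneg yG_meas, of u
        "\<lambda>_. 1" "{}"] that comp(3)[OF that] int1[of u]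
    by (auto simp: Y_def finite_subset[of u "{1..N}"])
  have mean: "expectation (\<lambda>\<omega>. y (X \<omega>)) = c"
  proof -
    have "expectation (\<lambda>\<omega>. y (X \<omega>)) = expectation (\<lambda>\<omega>. c + (\<Sum>u\<in>?A. Y u \<omega>))"
      using decomp' by (intro integral_cong_AE) auto
    also have "\<dots> = c + (\<Sum>u\<in>?A. expectation (Y u))"
    proof -
      have int_A: "integrable M (Y u)" if "u \<in> ?A" for u
        using that int1 by blast
      have "integrable M (\<lambda>\<omega>. \<Sum>u\<in>?A. Y u \<omega>)"
        by (rule Bochner_Integration.integrable_sum) (rule int_A)
      then have "expectation (\<lambda>\<omega>. c + (\<Sum>u\<in>?A. Y u \<omega>)) = c + expectation (\<lambda>\<omega>. \<Sum>u\<in>?A. Y u \<omega>)"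
        by (subst Bochner_Integration.integral_add) (simp_all only: integrable_const lebesgue_integral_const prob_space scaleR_one)
      also have "expectation (\<lambda>\<omega>. \<Sum>u\<in>?A. Y u \<omega>) = (\<Sum>u\<in>?A. expectation (Y u))"
        by (rule Bochner_Integration.integral_sum) (rule int_A)
      finally show ?thesis .
    qed
    finally show ?thesis by (simp add: mean0)
  qed
  \<comment> \<open>Subtracting the mean \<open>c\<close> cancels the component of the empty
    set.\<close>
  have "variance (\<lambda>\<omega>. y (X \<omega>)) = expectation (\<lambda>\<omega>. (\<Sum>u\<in>?A. Y u \<omega>)\<^sup>2)"
    unfolding mean using decomp' by (intro integral_cong_AE) auto
  also have "\<dots> = expectation (\<lambda>\<omega>. \<Sum>(u, v)\<in>?A \<times> ?A. Y u \<omega> * Y v \<omega>)"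
    by (simp only: power2_eq_square sum_product sum.cartesian_product)
  also have "\<dots> = (\<Sum>(u, v)\<in>?A \<times> ?A. E u v)"
    unfolding E_def split_beta
    by (rule Bochner_Integration.integral_sum, rule int) auto
  \<comment> \<open>A pair in \<open>?A \<times> ?A\<close> is diagonal, incomparable or strictly
    nested. Nested pairs contribute 0 by \<open>orth\<close>, with symmetry of \<open>E\<close>
    covering both directions of inclusion.\<close>
  also have "\<dots> = (\<Sum>(u, v)\<in>(\<lambda>u. (u, u)) ` ?A \<union> ?C. E u v)"
  proof (rule sum.mono_neutral_right)
    show "\<forall>p\<in>?A \<times> ?A - ((\<lambda>u. (u, u)) ` ?A \<union> ?C). (case p of (u, v) \<Rightarrow> E u v) = 0"
    proof
      fix p assume p: "p \<in> ?A \<times> ?A - ((\<lambda>u. (u, u)) ` ?A \<union> ?C)"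
      obtain u v where uv: "p = (u, v)" by (cases p)
      have "u \<subseteq> {1..N}" "v \<subseteq> {1..N}" "u \<subset> v \<or> v \<subset> u"
        using p unfolding uv by blast+
      then have "E u v = 0"
        using orth[of u v] orth[of v u] E_commute[of u v] by argo
      then show "(case p of (u, v) \<Rightarrow> E u v) = 0"
        by (simp add: uv)
    qed
    show "finite (?A \<times> ?A)"
      using A(1) by (rule finite_cartesian_product) (rule A(1))
    show "(\<lambda>u. (u, u)) ` ?A \<union> ?C \<subseteq> ?A \<times> ?A"
      by blast
  qed
  \<comment> \<open>The diagonal is disjoint from \<open>?C\<close> because every set contains
    itself; reindexing it by \<open>u\<close> gives the second moments.\<close>
  also have "\<dots> = (\<Sum>u\<in>?A. E u u) + (\<Sum>(u, v)\<in>?C. E u v)"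
  proof -
    have C: "finite ?C"
      by (rule finite_subset[OF _ finite_cartesian_product[OF A(1) A(1)]]) blast
    have disj: "(\<lambda>u. (u, u)) ` ?A \<inter> ?C = {}"
      by blast
    have inj: "inj_on (\<lambda>u. (u, u)) ?A"
      by (rule inj_onI) blast
    show ?thesis
      unfolding sum.union_disjoint[OF finite_imageI[OF A(1)] C disj] sum.reindex[OF inj]
      by (simp only: o_def prod.case)
  qed
  finally show ?thesis
    using mean unfolding E_def Y_def power2_eq_square by blast
qed

end
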